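(* Let $n\ge 3$ and let $R$ be a planar robot arm with segment lengths $l_{n-1}\ge l_{n-2}\ge\cdots\ge l_1\ge l_0>0$. If the base-length $z$ is continuously decreased, starting at $\infty$ (state block $[>;\,z\in(l_{n-1},\infty)]$), then there are only three possible classes of paths (through state transitions) that the system can take. These classes, and the respective conditions under which the system takes them, are: I. $\mathsf{B}\,\mathsf{E}\,\mathsf{G}$ (including $\overline{\mathsf{BE}}\,\mathsf{G}$, i.e. the possibility that $\mathsf{B}$ and $\mathsf{E}$ are simultaneous when the block $[>;\,z\in(l_{n-3},l_{n-1})]$ is empty), i.e. the succession of state blocks $$[>;(l_{n-1},\infty)]\to[>;(l_{n-3},l_{n-1})]\to[>;(0,l_{n-3})]\to[<;(0,l_{n-3})]:$$ taken when $l_{n-2}\le\sum_{i=0}^{n-3}l_i$. II. $\mathsf{A}\,\mathsf{C}\,\mathsf{D}\,\mathsf{E}\,\mathsf{G}$, i.e. the succession of state blocks $$[>;(l_{n-1},\infty)]\to[<;(l_{n-1},\infty)]\to[<;(l_{n-3},l_{n-1})]\to[>;(l_{n-3},l_{n-1})]\to[>;(0,l_{n-3})]\to[<;(0,l_{n-3})]:$$ taken when $l_{n-2}>\sum_{i=0}^{n-3}l_i$, and either $n\ne 3$ or $l_{n-1}\ne l_{n-2}$. III. $\mathsf{A}\,\mathsf{C}\,\mathsf{F}$, i.e. the succession of state blocks $$[>;(l_{n-1},\infty)]\to[<;(l_{n-1},\infty)]\to[<;(l_{n-3},l_{n-1})]\to[<;(0,l_{n-3})]:$$ taken when $l_{n-2}>\sum_{i=0}^{n-3}l_i$,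 $n=3$ and $l_{n-1}=l_{n-2}$. Here (i) depending on the minimum value that $z$ can assume for the arm, the system may not traverse a path in a class in its entirety as $z$ is decreased continuously (the path is then cut off when $z$ reaches its minimum possible value, with $z$ always kept positive); and (ii) since class III involves an equality condition, the systems following a path in that class form a set of measure zero in the space of all systems (a system being defined by $n$ and the lengths $l_{n-1},\dots,l_0$).
   Context: The configurations of a planar arm with $n$ segments of lengths $l_{n-1},\dots,l_0$ (listed from the base, which is at the origin) are $[\theta_{n-1},\dots,\theta_0]\in\mathbb{T}^n=(\mathbb{S}^1)^n$, $\theta_j$ being the angle of segment $j$ with the positive $X$ axis. The restricted configuration space is $$\mathfrak{R}=\Big\{[\theta_{n-1},\dots,\theta_0]\in\mathbb{T}^n:\ \sum_{j=0}^{n-1}l_j\sin\theta_j=0,\ \sum_{j=0}^{n-1}l_j\cos\theta_j>0\Big\},$$ and the base-length of such a configuration is $z=\sum_j l_j\cos\theta_j>0$. There are no obstacles, joint limits or self-collisions. The attainable values of $z$ are bounded above by $\sum_{j}l_j$, and bounded below by $l_{n-1}-\sum_{j=0}^{n-2}l_j$ if this is positive and by $0$ otherwise. Given $z$, let $l_{\langle n\rangle}\ge l_{\langle n-1\rangle}\ge\cdots\ge l_{\langle 0\rangle}$ be the $n+1$ numbers $z,l_{n-1},\dots,l_0$ sorted in order of magnitude. State blocks (sets of configurations; membership depends only on $z$). In each case the sign $>$ (resp. $<$) means that $l_{\langle n\rangle}+\sum_{j=0}^{n-3}l_{\langle j\rangle}>l_{\langle n-1\rangle}+l_{\langle n-2\rangle}$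 (resp. $<$), and the interval is the one in which $z$ lies. Explicitly: - $[\gtrless;\,z\in(l_{n-1},\infty)]$: $z\in(l_{n-1},\infty)$ and $z+\sum_{j=0}^{n-3}l_j\gtrless l_{n-1}+l_{n-2}$. - $[\gtrless;\,z\in(l_{n-3},l_{n-1})]$: $z\in(l_{n-3},l_{n-1})$ and $l_{n-1}+\sum_{j=0}^{n-3}l_j\gtrless z+l_{n-2}$. - $[\gtrless;\,z\in(0,l_{n-3})]$: $z\in(0,l_{n-3})$ and $l_{n-1}+z+\sum_{j=0}^{n-4}l_j\gtrless l_{n-2}+l_{n-3}$. We abbreviate $[\gtrless;\,z\in(\alpha,\beta)]$ to $[\gtrless;(\alpha,\beta)]$. For a given arm some state blocks may be empty (no valid configuration satisfies the conditions); empty blocks can be skipped along a path. State transitions (as $z$ decreases, except that each also has an inverse), with the values of $z$ at which they occur: - $\mathsf{A}$: $[>;(l_{n-1},\infty)]\to[<;(l_{n-1},\infty)]$, at $z_{\mathsf A}=l_{n-1}+l_{n-2}-\sum_{j=0}^{n-3}l_j$. - $\mathsf{B}$: $[>;(l_{n-1},\infty)]\to[>;(l_{n-3},l_{n-1})]$, at $z_{\mathsf B}=l_{n-1}$. - $\mathsf{C}$: $[<;(l_{n-1},\infty)]\to[<;(l_{n-3},l_{n-1})]$, at $z_{\mathsf C}=l_{n-1}$. - $\mathsf{D}$: the change between $[<;(l_{n-3},l_{n-1})]$ and $[>;(l_{n-3},l_{n-1})]$, at $z_{\mathsf D}=l_{n-1}-l_{n-2}+\sum_{j=0}^{n-3}l_j$.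 - $\mathsf{E}$: $[>;(l_{n-3},l_{n-1})]\to[>;(0,l_{n-3})]$, at $z_{\mathsf E}=l_{n-3}$. - $\mathsf{F}$: $[<;(l_{n-3},l_{n-1})]\to[<;(0,l_{n-3})]$, at $z_{\mathsf F}=l_{n-3}$. - $\mathsf{G}$: $[>;(0,l_{n-3})]\to[<;(0,l_{n-3})]$, at $z_{\mathsf G}=l_{n-2}+l_{n-3}-l_{n-1}-\sum_{j=0}^{n-4}l_j$. - $\overline{\mathsf{BE}}$: $[>;(l_{n-1},\infty)]\to[>;(0,l_{n-3})]$, possible only when $l_{n-1}=l_{n-2}=l_{n-3}$, at $z=l_{n-1}$. Empty sums are $0$. A path of the system is the succession of transitions met as $z$ decreases continuously, written as a word in the transition symbols. *)

theory Defs
  imports "HOL-Analysis.Analysis"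
begin

section \<open>Planar arms and their restricted configuration space\<close>

text \<open>Only the values \<open>l 0, \<dots>, l (n - 1)\<close> of the length function matter; segment \<open>n - 1\<close> is at
  the base.\<close>

definition planar_arm :: "nat \<Rightarrow> (nat \<Rightarrow> real) \<Rightarrow> bool" where
  "planar_arm n l \<longleftrightarrow> 3 \<le> n \<and> (\<forall>i<n. 0 < l i) \<and> (\<forall>i j. i \<le> j \<and> j < n \<longrightarrow> l i \<le> l j)"

text \<open>An angle is a point \<open>cis \<theta>\<close> of the unit circle, so that \<open>cos \<theta>\<close> and \<open>sin \<theta>\<close> are its real and
  imaginary parts.\<close>

definition torus :: "nat \<Rightarrow> (nat \<Rightarrow> complex) set" where
  "torus n = (\<Pi>\<^sub>E j\<in>{..<n}. sphere 0 1)"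

definition base_length :: "nat \<Rightarrow> (nat \<Rightarrow> real) \<Rightarrow> (nat \<Rightarrow> complex) \<Rightarrow> real" where
  "base_length n l u = (\<Sum>j<n. l j * Re (u j))"

definition restricted_config :: "nat \<Rightarrow> (nat \<Rightarrow> real) \<Rightarrow> (nat \<Rightarrow> complex) set" where
  "restricted_config n l = {u \<in> torus n. (\<Sum>j<n. l j * Im (u j)) = 0 \<and> 0 < base_length n l u}"

text \<open>The infimum is the least base-length when it is positive; when it is \<open>0\<close> it is not attained.\<close>

definition min_base_length :: "nat \<Rightarrow> (nat \<Rightarrow> real) \<Rightarrow> real" where
  "min_base_length n l = Inf (base_length n l ` restricted_config n l)"


section \<open>State blocks\<close>

text \<open>\<open>sorted_length n l z j\<close> is \<open>l\<^sub>\<langle>\<^sub>j\<^sub>\<rangle>\<close>, the entry of index \<open>j\<close> (counted from the smallest) among the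
  \<open>n + 1\<close> numbers \<open>z, l (n - 1), \<dots>, l 0\<close>.\<close>

definition sorted_length :: "nat \<Rightarrow> (nat \<Rightarrow> real) \<Rightarrow> real \<Rightarrow> nat \<Rightarrow> real" where
  "sorted_length n l z j = sort (z # map l [0..<n]) ! j"

datatype block_sign = Gt | Lt

datatype zone = High | Mid | Low

type_synonym block = "block_sign \<times> zone"

fun zone_interval :: "nat \<Rightarrow> (nat \<Rightarrow> real) \<Rightarrow> zone \<Rightarrow> real set" where
  "zone_interval n l High = {l (n - 1)<..}"
| "zone_interval n l Mid = {l (n - 3)<..<l (n - 1)}"
| "zone_interval n l Low = {0<..<l (n - 3)}"

fun sign_condition :: "nat \<Rightarrow> (nat \<Rightarrow> real) \<Rightarrow> real \<Rightarrow> block_sign \<Rightarrow> bool" where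
  "sign_condition n l z Gt \<longleftrightarrow>
     sorted_length n l z n + (\<Sum>j<n - 2. sorted_length n l z j)
       > sorted_length n l z (n - 1) + sorted_length n l z (n - 2)"
| "sign_condition n l z Lt \<longleftrightarrow>
     sorted_length n l z n + (\<Sum>j<n - 2. sorted_length n l z j)
       < sorted_length n l z (n - 1) + sorted_length n l z (n - 2)"

definition state_block :: "nat \<Rightarrow> (nat \<Rightarrow> real) \<Rightarrow> block \<Rightarrow> (nat \<Rightarrow> complex) set" where
  "state_block n l b = {u \<in> restricted_config n l.
     base_length n l u \<in> zone_interval n l (snd b) \<and> sign_condition n l (base_length n l u) (fst b)}"


text \<open>The sign conditions written out in terms of \<open>z\<close> and the lengths, zone by zone.\<close>

lemma sorted_length_eqI:
  assumes "sorted xs" "mset xs = mset (z # map l [0..<n])"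
  shows "sorted_length n l z j = xs ! j"
  unfolding sorted_length_def using properties_for_sort[OF assms(2,1)] by simp

lemma sorted_map_lengths:
  assumes "planar_arm n l" "m \<le> n"
  shows "sorted (map l [0..<m])"
  using assms by (auto simp: planar_arm_def sorted_iff_nth_mono)

lemma sum_nth_append:
  fixes xs :: "real list"
  assumes "length xs = k"
  shows "(\<Sum>j<k. (xs @ ys) ! j) = sum_list xs"
  using assms by (simp add: sum_list_sum_nth nth_append atLeast0LessThan)

lemma sum_list_map_upt: "sum_list (map l [0..<m]) = (\<Sum>j<m. l j)" for l :: "nat \<Rightarrow> real"
  by (simp add: interv_sum_list_conv_sum_set_nat atLeast0LessThan)

lemma upt_split_top:
  assumes "3 \<le> n"
  shows "[0..<n] = [0..<n - 3] @ [n - 3, n - 2, n - 1]"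
proof -
  obtain m where "n = Suc (Suc (Suc m))"
    using assms by (metis Suc_le_D numeral_3_eq_3 Suc_le_mono)
  then show ?thesis by simp
qed

lemma sign_condition_High:
  assumes arm: "planar_arm n l" and z: "z \<in> zone_interval n l High"
  shows "sign_condition n l z Gt \<longleftrightarrow> z + (\<Sum>j<n - 2. l j) > l (n - 1) + l (n - 2)"
    and "sign_condition n l z Lt \<longleftrightarrow> z + (\<Sum>j<n - 2. l j) < l (n - 1) + l (n - 2)"
proof -
  have n: "3 \<le> n" and mono: "\<And>i j. i \<le> j \<Longrightarrow> j < n \<Longrightarrow> l i \<le> l j"
    using arm by (auto simp: planar_arm_def)
  have top: "l i \<le> z" if "i < n" for i
    using mono[of i "n - 1"] that z n by fastforce
  let ?xs = "map l [0..<n] @ [z]"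
  have "sorted ?xs"
    using sorted_map_lengths[OF arm order_refl] top by (auto simp: sorted_append)
  then have eq: "sorted_length n l z j = ?xs ! j" for j
    by (rule sorted_length_eqI) simp
  have "sorted_length n l z n = z" "sorted_length n l z (n - 1) = l (n - 1)"
    "sorted_length n l z (n - 2) = l (n - 2)"
    "(\<Sum>j<n - 2. sorted_length n l z j) = (\<Sum>j<n - 2. l j)"
    using n by (auto simp: eq nth_append intro!: sum.cong)
  then show "sign_condition n l z Gt \<longleftrightarrow> z + (\<Sum>j<n - 2. l j) > l (n - 1) + l (n - 2)"
    and "sign_condition n l z Lt \<longleftrightarrow> z + (\<Sum>j<n - 2. l j) < l (n - 1) + l (n - 2)"
    by auto
qed

lemma sign_condition_Mid:
  assumes arm: "planar_arm n l" and z: "z \<in> zone_interval n l Mid"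
  shows "sign_condition n l z Gt \<longleftrightarrow> l (n - 1) + (\<Sum>j<n - 2. l j) > z + l (n - 2)"
    and "sign_condition n l z Lt \<longleftrightarrow> l (n - 1) + (\<Sum>j<n - 2. l j) < z + l (n - 2)"
proof -
  have n: "3 \<le> n" and mono: "\<And>i j. i \<le> j \<Longrightarrow> j < n \<Longrightarrow> l i \<le> l j"
    using arm by (auto simp: planar_arm_def)
  have low: "l i \<le> min z (l (n - 2))" if "i < n - 2" for i
  proof -
    have "i \<le> n - 3" using that by linarith
    then show ?thesis
      using mono[of i "n - 3"] mono[of i "n - 2"] that z n by fastforce
  qed
  have up: "max z (l (n - 2)) \<le> l (n - 1)"
    using mono[of "n - 2" "n - 1"] z n by auto
  let ?xs = "map l [0..<n - 2] @ [min z (l (n - 2)), max z (l (n - 2)), l (n - 1)]"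
  have "sorted ?xs"
    using sorted_map_lengths[OF arm, of "n - 2"] low up by (force simp: sorted_append)
  moreover have "[0..<n - 2] = [0..<n - 3] @ [n - 3]"
  proof -
    have "n - 2 = Suc (n - 3)" using n by linarith
    then show ?thesis by simp
  qed
  then have "mset ?xs = mset (z # map l [0..<n])"
    by (simp add: upt_split_top[OF n] min_def max_def)
  ultimately have eq: "sorted_length n l z j = ?xs ! j" for j
    by (rule sorted_length_eqI)
  have idx: "sorted_length n l z (n - 2 + k) =
      [min z (l (n - 2)), max z (l (n - 2)), l (n - 1)] ! k" for k
    unfolding eq nth_append by simp
  have "sorted_length n l z (n - 2) = min z (l (n - 2))"
    "sorted_length n l z (n - 1) = max z (l (n - 2))" "sorted_length n l z n = l (n - 1)"
    using idx[of 0] idx[of 1] idx[of 2] n by (simp_all add: numeral_2_eq_2 Suc_diff_Suc)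
  moreover have "(\<Sum>j<n - 2. sorted_length n l z j) = (\<Sum>j<n - 2. l j)"
    by (auto simp: eq nth_append intro!: sum.cong)
  ultimately show "sign_condition n l z Gt \<longleftrightarrow> l (n - 1) + (\<Sum>j<n - 2. l j) > z + l (n - 2)"
    and "sign_condition n l z Lt \<longleftrightarrow> l (n - 1) + (\<Sum>j<n - 2. l j) < z + l (n - 2)"
    by (auto simp: min_def max_def)
qed

lemma sign_condition_Low:
  assumes arm: "planar_arm n l" and z: "z \<in> zone_interval n l Low"
  shows "sign_condition n l z Gt \<longleftrightarrow>
           l (n - 1) + z + (\<Sum>j<n - 3. l j) > l (n - 2) + l (n - 3)"
    and "sign_condition n l z Lt \<longleftrightarrow>
           l (n - 1) + z + (\<Sum>j<n - 3. l j) < l (n - 2) + l (n - 3)"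
proof -
  have n: "3 \<le> n" and mono: "\<And>i j. i \<le> j \<Longrightarrow> j < n \<Longrightarrow> l i \<le> l j"
    using arm by (auto simp: planar_arm_def)
  let ?ys = "sort (z # map l [0..<n - 3])"
  let ?xs = "?ys @ [l (n - 3), l (n - 2), l (n - 1)]"
  have ys: "set ?ys = insert z (l ` {0..<n - 3})"
    by (simp only: set_sort) simp
  have "\<forall>x\<in>set ?ys. x \<le> l (n - 3)"
    unfolding ys using z mono[of _ "n - 3"] n by auto
  moreover have "l (n - 3) \<le> l (n - 2)" "l (n - 2) \<le> l (n - 1)"
    using mono[of "n - 3" "n - 2"] mono[of "n - 2" "n - 1"] n by auto
  ultimately have "sorted ?xs"
    using sorted_sort[of "z # map l [0..<n - 3]"]
    by (force simp only: sorted_append sorted_simps list.set)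
  moreover have "mset ?xs = mset (z # map l [0..<n])"
    by (simp add: upt_split_top[OF n])
  ultimately have eq: "sorted_length n l z j = ?xs ! j" for j
    by (rule sorted_length_eqI)
  have len: "length ?ys = n - 2"
    using n by (simp only: length_sort) simp
  have idx: "sorted_length n l z (n - 2 + k) = [l (n - 3), l (n - 2), l (n - 1)] ! k" for k
    unfolding eq nth_append len by simp
  have "sorted_length n l z (n - 2) = l (n - 3)" "sorted_length n l z (n - 1) = l (n - 2)"
    "sorted_length n l z n = l (n - 1)"
    using idx[of 0] idx[of 1] idx[of 2] n by (simp_all add: numeral_2_eq_2 Suc_diff_Suc)
  moreover have "(\<Sum>j<n - 2. sorted_length n l z j) = sum_list ?ys"
    unfolding eq by (rule sum_nth_append) (rule len)
  moreover have "sum_list ?ys = z + (\<Sum>j<n - 3. l j)"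
  proof -
    have "sum_list ?ys = sum_list (z # map l [0..<n - 3])"
      by (metis mset_sort sum_mset_sum_list)
    then show ?thesis by (simp only: sum_list.Cons sum_list_map_upt)
  qed
  ultimately show "sign_condition n l z Gt \<longleftrightarrow>
      l (n - 1) + z + (\<Sum>j<n - 3. l j) > l (n - 2) + l (n - 3)"
    and "sign_condition n l z Lt \<longleftrightarrow>
      l (n - 1) + z + (\<Sum>j<n - 3. l j) < l (n - 2) + l (n - 3)"
    by auto
qed


section \<open>State transitions\<close>

datatype transition = trA | trB | trC | trD | trE | trF | trG | trBE

text \<open>\<open>trD\<close> is admitted in both directions; that a decreasing base-length can only take it from
  \<open>Lt\<close> to \<open>Gt\<close> is not built in.\<close>

fun transition_step :: "nat \<Rightarrow> (nat \<Rightarrow> real) \<Rightarrow> transition \<Rightarrow> block \<Rightarrow> block \<Rightarrow> bool" where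
  "transition_step n l trA b b' \<longleftrightarrow> b = (Gt, High) \<and> b' = (Lt, High)"
| "transition_step n l trB b b' \<longleftrightarrow> b = (Gt, High) \<and> b' = (Gt, Mid)"
| "transition_step n l trC b b' \<longleftrightarrow> b = (Lt, High) \<and> b' = (Lt, Mid)"
| "transition_step n l trD b b' \<longleftrightarrow>
     b = (Lt, Mid) \<and> b' = (Gt, Mid) \<or> b = (Gt, Mid) \<and> b' = (Lt, Mid)"
| "transition_step n l trE b b' \<longleftrightarrow> b = (Gt, Mid) \<and> b' = (Gt, Low)"
| "transition_step n l trF b b' \<longleftrightarrow> b = (Lt, Mid) \<and> b' = (Lt, Low)"
| "transition_step n l trG b b' \<longleftrightarrow> b = (Gt, Low) \<and> b' = (Lt, Low)"
| "transition_step n l trBE b b' \<longleftrightarrow>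
     b = (Gt, High) \<and> b' = (Gt, Low) \<and> l (n - 1) = l (n - 2) \<and> l (n - 2) = l (n - 3)"

fun transition_value :: "nat \<Rightarrow> (nat \<Rightarrow> real) \<Rightarrow> transition \<Rightarrow> real" where
  "transition_value n l trA = l (n - 1) + l (n - 2) - (\<Sum>j<n - 2. l j)"
| "transition_value n l trB = l (n - 1)"
| "transition_value n l trC = l (n - 1)"
| "transition_value n l trD = l (n - 1) - l (n - 2) + (\<Sum>j<n - 2. l j)"
| "transition_value n l trE = l (n - 3)"
| "transition_value n l trF = l (n - 3)"
| "transition_value n l trG = l (n - 2) + l (n - 3) - l (n - 1) - (\<Sum>j<n - 3. l j)"
| "transition_value n l trBE = l (n - 1)"


section \<open>Paths\<close>

text \<open>The base-lengths at which exactly the first \<open>i\<close> transitions of the word \<open>w\<close> have been made. Like the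
  transition values, the minimum is excluded: it may itself be a transition value, whose configurations
  lie in no block.\<close>

definition window :: "nat \<Rightarrow> (nat \<Rightarrow> real) \<Rightarrow> transition list \<Rightarrow> nat \<Rightarrow> real set" where
  "window n l w i = {z. min_base_length n l < z \<and> (\<forall>j<i. z < transition_value n l (w ! j)) \<and>
     (\<forall>j. i \<le> j \<and> j < length w \<longrightarrow> transition_value n l (w ! j) < z)}"

text \<open>\<open>run n l (bs, w)\<close>: as \<open>z\<close> decreases through all its attainable values, the transitions \<open>w\<close> are
  made in this order, each at its own value of \<open>z\<close>, leading through the blocks \<open>bs\<close>. All transitions
  of \<open>w\<close> occur before the least base-length is reached. Transitions may be simultaneous, but a block
  passed without any configuration being in it at that moment must be empty.\<close>

definition run :: "nat \<Rightarrow> (nat \<Rightarrow> real) \<Rightarrow> block list \<times> transition list \<Rightarrow> bool" where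
  "run n l = (\<lambda>(bs, w).
     length bs = Suc (length w) \<and>
     bs ! 0 = (Gt, High) \<and>
     (\<forall>i<length w. transition_step n l (w ! i) (bs ! i) (bs ! Suc i)) \<and>
     sorted_wrt (\<ge>) (map (transition_value n l) w) \<and>
     (\<forall>t\<in>set w. min_base_length n l < transition_value n l t) \<and>
     (\<forall>i\<le>length w. \<forall>u\<in>restricted_config n l.
        base_length n l u \<in> window n l w i \<longrightarrow> u \<in> state_block n l (bs ! i)) \<and>
     (\<forall>i\<le>length w. (\<forall>u\<in>restricted_config n l. base_length n l u \<notin> window n l w i) \<longrightarrow>
        state_block n l (bs ! i) = {}))"

text \<open>A path makes no detour through empty blocks. Without the minimality, an arm with
  \<open>l (n - 2) = (\<Sum>j<n - 2. l j)\<close>, say, could replace \<open>trB\<close> by the three simultaneous transitions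
  \<open>trA\<close>, \<open>trC\<close>, \<open>trD\<close> through two empty blocks. For a generic arm there is only one run.\<close>

definition system_path :: "nat \<Rightarrow> (nat \<Rightarrow> real) \<Rightarrow> block list \<times> transition list \<Rightarrow> bool" where
  "system_path n l p \<longleftrightarrow> run n l p \<and> (\<forall>p'. run n l p' \<longrightarrow> length (snd p) \<le> length (snd p'))"

datatype path_class = Class_I | Class_II | Class_III

fun class_paths :: "path_class \<Rightarrow> (block list \<times> transition list) set" where
  "class_paths Class_I =
     {([(Gt, High), (Gt, Mid), (Gt, Low), (Lt, Low)], [trB, trE, trG]),
      ([(Gt, High), (Gt, Low), (Lt, Low)], [trBE, trG])}"
| "class_paths Class_II =
     {([(Gt, High), (Lt, High), (Lt, Mid), (Gt, Mid), (Gt, Low), (Lt, Low)],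
       [trA, trC, trD, trE, trG])}"
| "class_paths Class_III =
     {([(Gt, High), (Lt, High), (Lt, Mid), (Lt, Low)], [trA, trC, trF])}"

text \<open>The part of a path traversed before \<open>z\<close> reaches its minimum.\<close>

definition cut_off ::
  "nat \<Rightarrow> (nat \<Rightarrow> real) \<Rightarrow> block list \<times> transition list \<Rightarrow> block list \<times> transition list" where
  "cut_off n l = (\<lambda>(bs, w).
     let w' = takeWhile (\<lambda>t. min_base_length n l < transition_value n l t) w
     in (take (Suc (length w')) bs, w'))"

definition takes_class :: "nat \<Rightarrow> (nat \<Rightarrow> real) \<Rightarrow> path_class \<Rightarrow> bool" where
  "takes_class n l c \<longleftrightarrow> (\<exists>p\<in>class_paths c. system_path n l (cut_off n l p))"

end

theory Submission
  imports Defs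
begin

text \<open>The attainable base-lengths form the interval from \<open>max 0 (a - b - c - T)\<close> to
  \<open>a + b + c + T\<close>, where \<open>a \<ge> b \<ge> c\<close> are the three longest segments and \<open>T\<close> is the sum of the others:
  adding the segments in increasing order, each intermediate distance from the end point is bridged
  by a triangle. Hence a base-length that is not a transition value determines its block, and every
  run must pass through each block that contains an interval above the minimum and must end in the
  block just above the minimum. The automaton of transitions has few walks of bounded length that
  meet these constraints. For \<open>b > c + T\<close> the value of \<open>trA\<close> lies strictly above \<open>a\<close>, so that the block
  \<open>(Lt, High)\<close> is inevitable; and then the value of \<open>trD\<close> is at least \<open>c\<close>, with equality exactly in class
  III, where \<open>(Gt, Mid)\<close> is empty.\<close>

section \<open>Attainable base-lengths\<close>

text \<open>By the law of cosines, \<open>x\<close> is the cosine of the angle that the side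
  \<open>t\<close> makes with the side \<open>r\<close>, and the triangle inequalities put it
  between -1 and 1. With \<open>w\<close> in that direction, the remaining side has length
  \<open>s\<close>.\<close>

lemma triangle_exists:
  fixes r s t :: real
  assumes "0 < r" "0 < s" "0 < t" "\<bar>s - t\<bar> \<le> r" "r \<le> s + t"
  obtains v w :: complex where "norm v = 1" "norm w = 1"
    "of_real s * v + of_real t * w = of_real r"
proof -
  define x where "x = (r\<^sup>2 + t\<^sup>2 - s\<^sup>2) / (2 * r * t)"
  have "s\<^sup>2 \<le> (r + t)\<^sup>2" "(r - t)\<^sup>2 \<le> s\<^sup>2"
    using assms by (auto intro!: power_mono simp flip: abs_le_square_iff)
  then have "r\<^sup>2 + t\<^sup>2 - s\<^sup>2 \<le> 2 * r * t" "- (2 * r * t) \<le> r\<^sup>2 + t\<^sup>2 - s\<^sup>2"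
    by (simp_all add: power2_eq_square algebra_simps)
  then have "\<bar>x\<bar> \<le> 1"
    using assms by (simp add: x_def abs_le_iff divide_le_eq le_divide_eq)
  then have x: "x\<^sup>2 \<le> 1"
    by (simp add: abs_square_le_1)
  define w where "w = Complex x (sqrt (1 - x\<^sup>2))"
  have w: "norm w = 1"
    using x by (simp add: w_def cmod_def)
  have "(norm (of_real r - of_real t * w))\<^sup>2 = (r - t * x)\<^sup>2 + t\<^sup>2 * (1 - x\<^sup>2)"
    using x by (simp add: w_def cmod_power2 power_mult_distrib)
  also have "\<dots> = r\<^sup>2 + t\<^sup>2 - 2 * r * t * x"
    by (simp add: power2_eq_square algebra_simps)
  also have "\<dots> = s\<^sup>2"
    using assms by (simp add: x_def)
  finally have "norm (of_real r - of_real t * w) = s"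
    using assms by (simp add: power2_eq_iff_nonneg)
  then have "norm ((of_real r - of_real t * w) / of_real s) = 1"
    using assms by (simp add: norm_divide)
  moreover have "of_real s * ((of_real r - of_real t * w) / of_real s) + of_real t * w = of_real r"
    using assms by simp
  ultimately show thesis
    using that w by blast
qed

text \<open>Induction on the number of sides: the shorter sides are made to span a suitable distance
  \<open>s\<close>, and a triangle with sides \<open>s\<close>, \<open>l (Suc k)\<close> and
  \<open>r\<close> attaches the longest one. The order of the lengths keeps \<open>s\<close> within
  reach of the induction hypothesis.\<close>

lemma polygon_exists:
  fixes l :: "nat \<Rightarrow> real"
  assumes "\<forall>i\<le>k. 0 < l i" "\<forall>i j. i \<le> j \<and> j \<le> k \<longrightarrow> l i \<le> l j"
    and "0 < r" "l k - (\<Sum>j<k. l j) \<le> r" "r \<le> (\<Sum>j\<le>k. l j)"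
  shows "\<exists>u. (\<forall>j. norm (u j) = 1) \<and> (\<Sum>j\<le>k. of_real (l j) * u j) = complex_of_real r"
  using assms
proof (induction k arbitrary: r)
  case 0
  then have "r = l 0" by simp
  then show ?case by (intro exI[of _ "\<lambda>_. 1"]) simp
next
  case (Suc k)
  let ?M = "\<Sum>j\<le>k. l j" and ?L = "l (Suc k)"
  have pos: "0 < ?L" and le: "l k \<le> ?L"
    using Suc.prems by auto
  have M: "?M = (\<Sum>j<k. l j) + l k"
    by (simp flip: lessThan_Suc_atMost)
  have nonneg: "0 \<le> (\<Sum>j<k. l j)" and lk: "0 < l k"
    using Suc.prems by (auto intro!: sum_nonneg simp: less_imp_le)
  have prems: "0 < r" "?L - ?M \<le> r" "r \<le> ?M + ?L"
    using Suc.prems by (simp_all add: lessThan_Suc_atMost del: sum.lessThan_Suc)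
  \<comment> \<open>The shorter sides are stretched to their total \<open>?M\<close> if the triangle
    with \<open>?L\<close> and \<open>r\<close> then closes; otherwise \<open>r < ?M - ?L\<close>,
    and \<open>s = r + ?L\<close> gives a degenerate triangle.\<close>
  define s where "s = (if ?M - ?L \<le> r then ?M else r + ?L)"
  have s: "0 < s" "l k - (\<Sum>j<k. l j) \<le> s" "s \<le> ?M" "\<bar>s - ?L\<bar> \<le> r" "r \<le> s + ?L"
    using prems pos le nonneg lk M by (auto simp: s_def)
  obtain u where u: "\<forall>j. norm (u j) = 1" "(\<Sum>j\<le>k. of_real (l j) * u j) = complex_of_real s"
    using Suc.IH[of s] Suc.prems s by auto
  obtain v w where vw: "norm v = 1" "norm w = 1"
    "of_real s * v + of_real ?L * w = complex_of_real r"
    using triangle_exists[OF \<open>0 < r\<close> s(1) pos s(4,5)] .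
  \<comment> \<open>Multiplication by the unit number \<open>v\<close> rotates the polygon ending at
    \<open>s\<close> into one ending at \<open>s * v\<close>.\<close>
  have "(\<Sum>j\<le>k. of_real (l j) * (if j = Suc k then w else u j * v)) = of_real s * v"
    by (simp flip: u(2) add: sum_distrib_right mult.assoc)
  then show ?case
    using u(1) vw by (intro exI[of _ "\<lambda>j. if j = Suc k then w else u j * v"]) (auto simp: norm_mult)
qed

text \<open>Block conditions and transition values involve only the three longest lengths and the
  sum of the others, so the argument becomes linear arithmetic in \<open>a\<close>,
  \<open>b\<close>, \<open>c\<close>, \<open>T\<close>. The index \<open>n - Suc 0\<close> is the
  simplifier's normal form of \<open>n - 1\<close>.\<close>

locale arm =
  fixes n :: nat and l :: "nat \<Rightarrow> real" and a b c T :: real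
  assumes planar: "planar_arm n l"
    and l_top [simp]: "l (n - Suc 0) = a" and l_second [simp]: "l (n - 2) = b"
    and l_third [simp]: "l (n - 3) = c" and sum_rest [simp]: "(\<Sum>j<n - 3. l j) = T"
begin

lemma three_le_n: "3 \<le> n"
  using planar by (simp add: planar_arm_def)

lemma lengths: "b \<le> a" "c \<le> b" "0 < c" "0 \<le> T"
proof -
  have "0 < l i" "i \<le> j \<Longrightarrow> l i \<le> l j" if "i < n" "j < n" for i j
    using planar that by (auto simp: planar_arm_def)
  from this[of "n - 3" "n - 3"] this(2)[of "n - 2" "n - 1"] this(2)[of "n - 3" "n - 2"]
  show "b \<le> a" "c \<le> b" "0 < c"
    using three_le_n by auto
  show "0 \<le> T"
    using planar by (auto simp: planar_arm_def less_imp_le simp flip: sum_rest intro!: sum_nonneg)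
qed

text \<open>All lengths are positive, so \<open>T\<close> vanishes only as an empty sum. This turns
  the condition on \<open>n\<close> that separates classes II and III into one on real
  numbers.\<close>

lemma rest_eq_0_iff: "T = 0 \<longleftrightarrow> n = 3"
proof
  assume "T = 0"
  show "n = 3"
  proof (rule ccontr)
    assume "n \<noteq> 3"
    then have "0 < (\<Sum>j<n - 3. l j)"
      using planar three_le_n by (intro sum_pos) (auto simp: planar_arm_def lessThan_empty_iff)
    then show False using \<open>T = 0\<close> by simp
  qed
qed (simp flip: sum_rest)

lemma sum_short [simp]: "(\<Sum>j<n - 2. l j) = c + T"
proof -
  have "n - 2 = Suc (n - 3)" using three_le_n by linarith
  then show ?thesis by simp
qed

lemma sum_but_top [simp]: "(\<Sum>j<n - Suc 0. l j) = b + c + T"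
proof -
  have "n - Suc 0 = Suc (n - 2)" using three_le_n by linarith
  then show ?thesis by simp
qed

lemma sum_all: "(\<Sum>j<n. l j) = a + b + c + T"
proof -
  have "n = Suc (n - Suc 0)" using three_le_n by linarith
  then have "(\<Sum>j<n. l j) = (\<Sum>j<n - Suc 0. l j) + l (n - Suc 0)"
    by (metis sum.lessThan_Suc)
  then show ?thesis by simp
qed

section \<open>The interval of attainable base-lengths\<close>

definition attainable :: "real set" where
  "attainable = base_length n l ` restricted_config n l"

text \<open>The two real equations for a configuration are one complex equation. The triangle
  inequality for the whole sum gives the upper bound; the same inequality after isolating the base
  segment gives the lower one.\<close>

lemma attainable_bounds:
  assumes "z \<in> attainable"
  shows "0 < z" "a - b - c - T \<le> z" "z \<le> a + b + c + T"
proof -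
  obtain u where u: "u \<in> torus n" "(\<Sum>j<n. l j * Im (u j)) = 0" "0 < z" "z = base_length n l u"
    using assms by (auto simp: attainable_def restricted_config_def)
  show "0 < z" by fact
  have sum: "(\<Sum>j<n. of_real (l j) * u j) = complex_of_real z"
    using u by (simp add: complex_eq_iff base_length_def)
  have norm_le: "norm (\<Sum>j<k. of_real (l j) * u j) \<le> (\<Sum>j<k. l j)" if "k \<le> n" for k
    using planar u(1) that
    by (intro order.trans[OF norm_sum] sum_mono)
      (auto simp: norm_mult planar_arm_def torus_def dist_norm less_imp_le PiE_iff)
  show "z \<le> a + b + c + T"
    using norm_le[of n] u(3) by (simp add: sum sum_all)
  have n: "n = Suc (n - Suc 0)" using three_le_n by linarith
  then have "norm (u (n - Suc 0)) = 1"
    using u(1) by (force simp: torus_def PiE_iff)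
  then have "a = norm (of_real a * u (n - Suc 0))"
    using lengths by (simp add: norm_mult)
  also have "of_real a * u (n - Suc 0) = of_real z - (\<Sum>j<n - Suc 0. of_real (l j) * u j)"
    using sum n by (metis (no_types, lifting) add_diff_cancel_left' l_top sum.lessThan_Suc)
  also have "norm \<dots> \<le> z + (b + c + T)"
    using norm_triangle_ineq4[of "of_real z" "\<Sum>j<n - Suc 0. of_real (l j) * u j"]
      norm_le[of "n - Suc 0"] u(3) by simp
  finally show "a - b - c - T \<le> z" by simp
qed

lemma attainableI:
  assumes "0 < z" "a - b - c - T \<le> z" "z \<le> a + b + c + T"
  shows "z \<in> attainable"
proof -
  have n: "{..n - Suc 0} = {..<n}"
    using three_le_n by auto
  have "\<exists>u. (\<forall>j. norm (u j) = 1) \<and>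
      (\<Sum>j\<le>n - Suc 0. of_real (l j) * u j) = complex_of_real z"
    using assms planar three_le_n
    by (intro polygon_exists) (auto simp: planar_arm_def n sum_all)
  then obtain u where u: "\<forall>j. norm (u j) = 1" "(\<Sum>j<n. of_real (l j) * u j) = complex_of_real z"
    unfolding n by blast
  \<comment> \<open>\<open>torus n\<close> is an extensional product, so the directions must be
    undefined beyond the arm.\<close>
  let ?u = "restrict u {..<n}"
  have "(\<Sum>j<n. of_real (l j) * ?u j) = complex_of_real z"
    using u(2) by simp
  then have "base_length n l ?u = z" "(\<Sum>j<n. l j * Im (?u j)) = 0"
    by (simp_all add: complex_eq_iff base_length_def)
  moreover have "?u \<in> torus n"
    using u(1) by (simp add: torus_def restrict_PiE_iff)
  ultimately have "?u \<in> restricted_config n l"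
    using assms(1) by (simp add: restricted_config_def)
  then show ?thesis
    using \<open>base_length n l ?u = z\<close> unfolding attainable_def by blast
qed

text \<open>The infimum \<open>0\<close> is not attained, so the value is identified as the greatest
  lower bound: anything larger is undercut by an attainable length.\<close>

lemma min_base_length_eq: "min_base_length n l = max 0 (a - b - c - T)"
  unfolding min_base_length_def attainable_def[symmetric]
proof (rule cInf_eq_non_empty)
  have "a + b + c + T \<in> attainable"
    using lengths by (intro attainableI) auto
  then show "attainable \<noteq> {}" by blast
  show "max 0 (a - b - c - T) \<le> z" if "z \<in> attainable" for z
    using attainable_bounds[OF that] by simp
  fix y
  assume y: "\<And>z. z \<in> attainable \<Longrightarrow> y \<le> z"
  show "y \<le> max 0 (a - b - c - T)"
  proof (rule ccontr)
    assume "\<not> ?thesis"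
    moreover have "max 0 (a - b - c - T) < a + b + c + T" using lengths by simp
    \<comment> \<open>The cap at the full length keeps the intermediate \<open>z\<close>
      attainable.\<close>
    ultimately have "max 0 (a - b - c - T) < min y (a + b + c + T)" by linarith
    then obtain z where "max 0 (a - b - c - T) < z" "z < min y (a + b + c + T)"
      using dense by blast
    then show False
      using y[of z] attainableI[of z] by simp
  qed
qed

abbreviation m :: real where "m \<equiv> min_base_length n l"

lemma min_bounds: "0 \<le> m" "a - b - c - T \<le> m" "m < a" "m = 0 \<or> m = a - b - c - T"
  using lengths by (auto simp: min_base_length_eq)

lemma attainable_interval: "m < z \<Longrightarrow> z \<le> a + b + c + T \<Longrightarrow> z \<in> attainable"
  using min_bounds by (intro attainableI) auto


section \<open>Runs in terms of base-lengths\<close>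

text \<open>Membership in a state block depends on the base-length alone, so conditions on sets of
  configurations can be replaced by conditions on sets of reals.\<close>

definition block_lengths :: "block \<Rightarrow> real set" where
  "block_lengths \<beta> = {z \<in> attainable. z \<in> zone_interval n l (snd \<beta>) \<and> sign_condition n l z (fst \<beta>)}"

lemma block_lengths_iff:
  "z \<in> block_lengths (Gt, High) \<longleftrightarrow> z \<in> attainable \<and> a < z \<and> a + b < z + c + T"
  "z \<in> block_lengths (Lt, High) \<longleftrightarrow> z \<in> attainable \<and> a < z \<and> z + c + T < a + b"
  "z \<in> block_lengths (Gt, Mid) \<longleftrightarrow> z \<in> attainable \<and> c < z \<and> z < a \<and> z + b < a + c + T"
  "z \<in> block_lengths (Lt, Mid) \<longleftrightarrow> z \<in> attainable \<and> c < z \<and> z < a \<and> a + c + T < z + b"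
  "z \<in> block_lengths (Gt, Low) \<longleftrightarrow> z \<in> attainable \<and> 0 < z \<and> z < c \<and> b + c < a + z + T"
  "z \<in> block_lengths (Lt, Low) \<longleftrightarrow> z \<in> attainable \<and> 0 < z \<and> z < c \<and> a + z + T < b + c"
  using sign_condition_High[OF planar, of z] sign_condition_Mid[OF planar, of z]
    sign_condition_Low[OF planar, of z]
  by (auto simp: block_lengths_def algebra_simps)

lemma block_lengths_disjoint:
  assumes "z \<in> block_lengths \<beta>" "z \<in> block_lengths \<beta>'"
  shows "\<beta> = \<beta>'"
proof -
  have "c \<le> a" using lengths by simp
  obtain s q s' q' where "\<beta> = (s, q)" "\<beta>' = (s', q')"
    by (metis surj_pair)
  then show ?thesis
    using assms \<open>c \<le> a\<close> by (cases s; cases q; cases s'; cases q') (auto simp: block_lengths_iff)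
qed

section \<open>Runs as walks with windows of base-lengths\<close>

abbreviation tv :: "transition \<Rightarrow> real" where "tv \<equiv> transition_value n l"

lemma window_iff:
  "z \<in> window n l w i \<longleftrightarrow>
     m < z \<and> (\<forall>t\<in>set (take i w). z < tv t) \<and> (\<forall>t\<in>set (drop i w). tv t < z)"
  if "i \<le> length w"
proof -
  have "(\<forall>t\<in>set (take i w). z < tv t) \<longleftrightarrow> (\<forall>j<i. z < tv (w ! j))"
    using that by (auto simp flip: nth_image simp: lessThan_atLeast0[symmetric])
  moreover have "(\<forall>t\<in>set (drop i w). tv t < z) \<longleftrightarrow> (\<forall>j. i \<le> j \<and> j < length w \<longrightarrow> tv (w ! j) < z)"
    (is "?L \<longleftrightarrow> ?R")
  proof
    assume L: ?L
    show ?R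
    proof (intro allI impI)
      fix j assume "i \<le> j \<and> j < length w"
      then have "w ! j = drop i w ! (j - i)" "j - i < length (drop i w)" by auto
      then show "tv (w ! j) < z" using L by (metis nth_mem)
    qed
  qed (auto simp: in_set_conv_nth)
  ultimately show ?thesis
    using that by (simp add: window_def)
qed

text \<open>Recursive form of the condition on consecutive blocks in \<open>run\<close>, from which
  short walks can be enumerated by unfolding along the word.\<close>

fun walk :: "block \<Rightarrow> transition list \<Rightarrow> block list \<Rightarrow> bool" where
  "walk \<beta> [] bs \<longleftrightarrow> bs = [\<beta>]"
| "walk \<beta> (t # w) bs \<longleftrightarrow> (\<exists>\<beta>' bs'. bs = \<beta> # bs' \<and> transition_step n l t \<beta> \<beta>' \<and> walk \<beta>' w bs')"

lemma walk_iff: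
  "walk \<beta> w bs \<longleftrightarrow> length bs = Suc (length w) \<and> bs ! 0 = \<beta> \<and>
     (\<forall>i<length w. transition_step n l (w ! i) (bs ! i) (bs ! Suc i))"
proof (induction w arbitrary: \<beta> bs)
  case Nil
  then show ?case by (cases bs) auto
next
  case (Cons t w)
  show ?case
  proof (cases bs)
    case (Cons \<gamma> bs')
    then show ?thesis
      by (auto simp: Cons.IH All_less_Suc2 simp del: split_paired_Ex)
  qed simp
qed

lemma run_iff:
  "run n l (bs, w) \<longleftrightarrow> walk (Gt, High) w bs \<and> sorted_wrt (\<ge>) (map tv w) \<and> (\<forall>t\<in>set w. m < tv t) \<and>
     (\<forall>i\<le>length w. attainable \<inter> window n l w i \<subseteq> block_lengths (bs ! i)) \<and>
     (\<forall>i\<le>length w. attainable \<inter> window n l w i = {} \<longrightarrow> block_lengths (bs ! i) = {})"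
proof -
  have "(\<forall>u\<in>restricted_config n l. base_length n l u \<in> W \<longrightarrow> u \<in> state_block n l \<beta>)
      \<longleftrightarrow> attainable \<inter> W \<subseteq> block_lengths \<beta>" for W \<beta>
    by (auto simp: attainable_def block_lengths_def state_block_def)
  moreover have "(\<forall>u\<in>restricted_config n l. base_length n l u \<notin> W) \<longleftrightarrow> attainable \<inter> W = {}" for W
    by (auto simp: attainable_def)
  moreover have "state_block n l \<beta> = {} \<longleftrightarrow> block_lengths \<beta> = {}" for \<beta>
    by (auto simp: attainable_def block_lengths_def state_block_def)
  ultimately show ?thesis
    by (simp add: run_def walk_iff)
qed

text \<open>Density between the minimum and the least element of \<open>V\<close>, capped by the
  full length. Applied to the transition values of a word, it shows that the last window is never
  empty.\<close>

lemma length_above_min: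
  assumes "finite V" "\<forall>v\<in>V. m < v"
  obtains z where "z \<in> attainable" "m < z" "\<forall>v\<in>V. z < v"
proof -
  let ?q = "Min (insert (a + b + c + T) V)"
  have "m < ?q"
    using assms min_bounds lengths by auto
  then obtain z where z: "m < z" "z < ?q" using dense by blast
  then have "z \<in> attainable"
    using assms by (intro attainable_interval) auto
  then show thesis
    using that[of z] z assms by auto
qed

text \<open>That an empty window forces an empty block is shown by contraposition: by
  \<open>covered\<close>, a length in the block lies in the window. \<open>covered\<close> stops
  before the last index because the last window always contains lengths just above the
  minimum.\<close>

lemma runI:
  assumes "walk (Gt, High) w bs" "sorted_wrt (\<ge>) (map tv w)" "\<forall>t\<in>set w. m < tv t"
    and inside: "\<And>i z. i \<le> length w \<Longrightarrow> z \<in> attainable \<Longrightarrow> m < z \<Longrightarrow>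
       \<forall>t\<in>set (take i w). z < tv t \<Longrightarrow> \<forall>t\<in>set (drop i w). tv t < z \<Longrightarrow> z \<in> block_lengths (bs ! i)"
    and covered: "\<And>i z. i < length w \<Longrightarrow> z \<in> block_lengths (bs ! i) \<Longrightarrow>
       (\<forall>t\<in>set (take i w). z < tv t) \<and> (\<forall>t\<in>set (drop i w). tv t < z)"
  shows "run n l (bs, w)"
  unfolding run_iff
proof (intro conjI allI impI)
  fix i assume i: "i \<le> length w"
  show "attainable \<inter> window n l w i \<subseteq> block_lengths (bs ! i)"
    using inside[OF i] i by (auto simp: window_iff)
  assume empty: "attainable \<inter> window n l w i = {}"
  obtain z where "z \<in> attainable" "m < z" "\<forall>v\<in>tv ` set w. z < v"
    using assms(3) by (rule_tac V = "tv ` set w" in length_above_min) auto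
  then have "z \<in> attainable \<inter> window n l w (length w)"
    by (simp add: window_iff)
  then have i: "i < length w"
    using i empty by (metis empty_iff le_neq_implies_less)
  have "z \<in> attainable \<inter> window n l w i" if z: "z \<in> block_lengths (bs ! i)" for z
  proof -
    \<comment> \<open>A transition is still ahead at \<open>z\<close>, so \<open>z\<close> exceeds
      its value and hence the minimum.\<close>
    have "w ! i \<in> set (drop i w)"
      using i by (metis Cons_nth_drop_Suc list.set_intros(1))
    then have "m < z"
      using covered[OF i z] assms(3) by (meson in_set_dropD less_trans)
    then show ?thesis
      using covered[OF i z] i z by (simp add: window_iff block_lengths_def)
  qed
  then show "block_lengths (bs ! i) = {}"
    using empty by blast
qed (use assms in auto)

text \<open>Transition values do not increase along the word, so those above \<open>z\<close> form a
  prefix, whose length is the index of the window of \<open>z\<close>. The run puts \<open>z\<close>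
  into the block of that index, and blocks are disjoint.\<close>

lemma run_block_at:
  assumes "run n l (bs, w)" "z \<in> block_lengths \<beta>" "m < z" "z \<notin> tv ` set w"
  shows "bs ! length (takeWhile (\<lambda>t. z < tv t) w) = \<beta>"
proof -
  let ?i = "length (takeWhile (\<lambda>t. z < tv t) w)"
  have "sorted_wrt (\<ge>) (map tv w)"
    using assms(1) by (simp add: run_iff)
  then have "\<forall>t\<in>set (dropWhile (\<lambda>t. z < tv t) w). tv t \<le> z"
    by (induction w) auto
  moreover have "set (dropWhile (\<lambda>t. z < tv t) w) \<subseteq> set w"
    using set_dropWhileD by fastforce
  ultimately have "\<forall>t\<in>set (dropWhile (\<lambda>t. z < tv t) w). tv t < z"
    using assms(4) by (force simp: less_le)
  then have "z \<in> window n l w ?i"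
    using assms(3)
    by (auto simp: window_iff length_takeWhile_le simp flip: takeWhile_eq_take dropWhile_eq_drop
        dest: set_takeWhileD)
  moreover have "z \<in> attainable" using assms(2) by (simp add: block_lengths_def)
  ultimately have "z \<in> block_lengths (bs ! ?i)"
    using assms(1) length_takeWhile_le[of "\<lambda>t. z < tv t" w] by (auto simp: run_iff)
  then show ?thesis
    using assms(2) block_lengths_disjoint by blast
qed

text \<open>The interval contains a length avoiding the finitely many transition values. The
  conclusion keeps this length because it fixes how many transitions have been made at the visit;
  words that are in the block at another moment are thereby excluded.\<close>

lemma run_visits:
  assumes "run n l (bs, w)" "{p<..<q} \<subseteq> block_lengths \<beta>" "m \<le> p" "p < q"
  shows "\<exists>z. p < z \<and> z < q \<and> bs ! length (takeWhile (\<lambda>t. z < tv t) w) = \<beta>"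
proof -
  have "infinite ({p<..<q} - tv ` set w)"
    using assms(4) by (simp add: infinite_Ioo)
  then obtain z where "z \<in> {p<..<q} - tv ` set w"
    by (metis finite.emptyI ex_in_conv)
  then show ?thesis
    using run_block_at[OF assms(1), of z \<beta>] assms by (intro exI[of _ z]) auto
qed

lemma run_visits_set:
  assumes "run n l (bs, w)" "{p<..<q} \<subseteq> block_lengths \<beta>" "m \<le> p" "p < q"
  shows "\<beta> \<in> set bs"
proof -
  have "length bs = Suc (length w)" using assms(1) by (simp add: run_def)
  then have "length (takeWhile (\<lambda>t. z < tv t) w) < length bs" for z
    by (simp add: length_takeWhile_le less_Suc_eq_le)
  then show ?thesis
    using run_visits[OF assms] nth_mem by blast
qed

text \<open>At a length below \<open>q\<close> and below all transition values, but above the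
  minimum, the whole word has been made.\<close>

lemma run_last:
  assumes "run n l (bs, w)" "{m<..<q} \<inter> attainable \<subseteq> block_lengths \<beta>" "m < q"
  shows "bs ! length w = \<beta>"
proof -
  obtain z where z: "z \<in> attainable" "m < z" "\<forall>v\<in>insert q (tv ` set w). z < v"
    using assms by (rule_tac V = "insert q (tv ` set w)" in length_above_min) (auto simp: run_iff)
  then have "z \<in> block_lengths \<beta>"
    using assms(2) by auto
  moreover have "takeWhile (\<lambda>t. z < tv t) w = w" "z \<notin> tv ` set w"
    using z(3) by (auto simp: takeWhile_eq_all_conv)
  ultimately show ?thesis
    using run_block_at[OF assms(1)] z(2) by metis
qed

text \<open>Yields minimality and uniqueness at once: a shorter or equally short run can only be
  \<open>p\<close> itself.\<close>

lemma system_path_eqI: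
  assumes "run n l p"
    and "\<And>bs w. run n l (bs, w) \<Longrightarrow> length w \<le> length (snd p) \<Longrightarrow> (bs, w) = p"
  shows "system_path n l p' \<longleftrightarrow> p' = p"
  using assms unfolding system_path_def by (metis linear prod.collapse)

section \<open>Enumeration of short walks\<close>

lemma transition_step_from:
  "transition_step n l t (Gt, High) \<beta> \<longleftrightarrow> t = trA \<and> \<beta> = (Lt, High) \<or> t = trB \<and> \<beta> = (Gt, Mid) \<or>
     t = trBE \<and> \<beta> = (Gt, Low) \<and> a = b \<and> b = c"
  "transition_step n l t (Lt, High) \<beta> \<longleftrightarrow> t = trC \<and> \<beta> = (Lt, Mid)"
  "transition_step n l t (Gt, Mid) \<beta> \<longleftrightarrow> t = trD \<and> \<beta> = (Lt, Mid) \<or> t = trE \<and> \<beta> = (Gt, Low)"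
  "transition_step n l t (Lt, Mid) \<beta> \<longleftrightarrow> t = trD \<and> \<beta> = (Gt, Mid) \<or> t = trF \<and> \<beta> = (Lt, Low)"
  "transition_step n l t (Gt, Low) \<beta> \<longleftrightarrow> t = trG \<and> \<beta> = (Lt, Low)"
  "\<not> transition_step n l t (Lt, Low) \<beta>"
  by (cases t; auto)+

text \<open>\<open>trD\<close> can be repeated back and forth, so there are infinitely many walks;
  the bound on the length makes the unfolding terminate.\<close>

lemma walk_bounded:
  "walk \<beta> w bs \<and> length w \<le> 0 \<longleftrightarrow> w = [] \<and> bs = [\<beta>]"
  "walk (Gt, High) w bs \<and> length w \<le> Suc k \<longleftrightarrow> w = [] \<and> bs = [(Gt, High)] \<or>
     (\<exists>w' bs'. w = trA # w' \<and> bs = (Gt, High) # bs' \<and> walk (Lt, High) w' bs' \<and> length w' \<le> k) \<or>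
     (\<exists>w' bs'. w = trB # w' \<and> bs = (Gt, High) # bs' \<and> walk (Gt, Mid) w' bs' \<and> length w' \<le> k) \<or>
     a = b \<and> b = c \<and> (\<exists>w' bs'. w = trBE # w' \<and> bs = (Gt, High) # bs' \<and> walk (Gt, Low) w' bs' \<and> length w' \<le> k)"
  "walk (Lt, High) w bs \<and> length w \<le> Suc k \<longleftrightarrow> w = [] \<and> bs = [(Lt, High)] \<or>
     (\<exists>w' bs'. w = trC # w' \<and> bs = (Lt, High) # bs' \<and> walk (Lt, Mid) w' bs' \<and> length w' \<le> k)"
  "walk (Gt, Mid) w bs \<and> length w \<le> Suc k \<longleftrightarrow> w = [] \<and> bs = [(Gt, Mid)] \<or>
     (\<exists>w' bs'. w = trD # w' \<and> bs = (Gt, Mid) # bs' \<and> walk (Lt, Mid) w' bs' \<and> length w' \<le> k) \<or>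
     (\<exists>w' bs'. w = trE # w' \<and> bs = (Gt, Mid) # bs' \<and> walk (Gt, Low) w' bs' \<and> length w' \<le> k)"
  "walk (Lt, Mid) w bs \<and> length w \<le> Suc k \<longleftrightarrow> w = [] \<and> bs = [(Lt, Mid)] \<or>
     (\<exists>w' bs'. w = trD # w' \<and> bs = (Lt, Mid) # bs' \<and> walk (Gt, Mid) w' bs' \<and> length w' \<le> k) \<or>
     (\<exists>w' bs'. w = trF # w' \<and> bs = (Lt, Mid) # bs' \<and> walk (Lt, Low) w' bs' \<and> length w' \<le> k)"
  "walk (Gt, Low) w bs \<and> length w \<le> Suc k \<longleftrightarrow> w = [] \<and> bs = [(Gt, Low)] \<or>
     (\<exists>w' bs'. w = trG # w' \<and> bs = (Gt, Low) # bs' \<and> walk (Lt, Low) w' bs' \<and> length w' \<le> k)"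
  "walk (Lt, Low) w bs \<and> length w \<le> Suc k \<longleftrightarrow> w = [] \<and> bs = [(Lt, Low)]"
  by (cases w; auto simp: transition_step_from simp del: split_paired_Ex)+

lemma walk_to_Gt_Mid:
  assumes "walk (Gt, High) w bs" "length w \<le> 1" "bs ! length w = (Gt, Mid)"
  shows "(bs, w) = ([(Gt, High), (Gt, Mid)], [trB])"
proof -
  \<comment> \<open>The bound is written in unary so that the equations of
    \<open>walk_bounded\<close> consume it one transition at a time.\<close>
  have "walk (Gt, High) w bs \<and> length w \<le> Suc (0)"
    using assms by simp
  then show ?thesis
    using assms(3-) by (simp only: walk_bounded) (elim disjE exE conjE; simp)
qed

lemma walk_to_Gt_Low:
  assumes "walk (Gt, High) w bs" "length w \<le> 2" "bs ! length w = (Gt, Low)"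
  shows "(bs, w) = ([(Gt, High), (Gt, Mid), (Gt, Low)], [trB, trE]) \<or>
    a = b \<and> b = c \<and> (bs, w) = ([(Gt, High), (Gt, Low)], [trBE])"
proof -
  have "walk (Gt, High) w bs \<and> length w \<le> Suc (Suc (0))"
    using assms by simp
  then show ?thesis
    using assms(3-) by (simp only: walk_bounded) (elim disjE exE conjE; simp)
qed

lemma walk_to_Lt_Low:
  assumes "walk (Gt, High) w bs" "length w \<le> 3" "bs ! length w = (Lt, Low)"
  shows "(bs, w) = ([(Gt, High), (Gt, Mid), (Gt, Low), (Lt, Low)], [trB, trE, trG]) \<or>
    (bs, w) = ([(Gt, High), (Gt, Mid), (Lt, Mid), (Lt, Low)], [trB, trD, trF]) \<or>
    (bs, w) = ([(Gt, High), (Lt, High), (Lt, Mid), (Lt, Low)], [trA, trC, trF]) \<or>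
    a = b \<and> b = c \<and> (bs, w) = ([(Gt, High), (Gt, Low), (Lt, Low)], [trBE, trG])"
proof -
  have "walk (Gt, High) w bs \<and> length w \<le> Suc (Suc (Suc (0)))"
    using assms by simp
  then show ?thesis
    using assms(3-) by (simp only: walk_bounded) (elim disjE exE conjE; simp)
qed

lemma walk_via_Lt_High_to_Gt_Mid:
  assumes "walk (Gt, High) w bs" "length w \<le> 3" "bs ! length w = (Gt, Mid)" "(Lt, High) \<in> set bs"
  shows "(bs, w) = ([(Gt, High), (Lt, High), (Lt, Mid), (Gt, Mid)], [trA, trC, trD])"
proof -
  have "walk (Gt, High) w bs \<and> length w \<le> Suc (Suc (Suc (0)))"
    using assms by simp
  then show ?thesis
    using assms(3-) by (simp only: walk_bounded) (elim disjE exE conjE; simp)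
qed

lemma walk_via_Lt_High_to_Gt_Low:
  assumes "walk (Gt, High) w bs" "length w \<le> 4" "bs ! length w = (Gt, Low)" "(Lt, High) \<in> set bs"
  shows "(bs, w) = ([(Gt, High), (Lt, High), (Lt, Mid), (Gt, Mid), (Gt, Low)], [trA, trC, trD, trE])"
proof -
  have "walk (Gt, High) w bs \<and> length w \<le> Suc (Suc (Suc (Suc (0))))"
    using assms by simp
  then show ?thesis
    using assms(3-) by (simp only: walk_bounded) (elim disjE exE conjE; simp)
qed

text \<open>The last word crosses \<open>trD\<close> back and forth. In class II the moment of a
  visit to \<open>(Gt, Mid)\<close> singles out the second word; in class III the length singles out
  the first.\<close>

lemma walk_via_Lt_High_to_Lt_Low:
  assumes "walk (Gt, High) w bs" "length w \<le> 5" "bs ! length w = (Lt, Low)" "(Lt, High) \<in> set bs"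
  shows "(bs, w) = ([(Gt, High), (Lt, High), (Lt, Mid), (Lt, Low)], [trA, trC, trF]) \<or>
    (bs, w) = ([(Gt, High), (Lt, High), (Lt, Mid), (Gt, Mid), (Gt, Low), (Lt, Low)], [trA, trC, trD, trE, trG]) \<or>
    (bs, w) = ([(Gt, High), (Lt, High), (Lt, Mid), (Gt, Mid), (Lt, Mid), (Lt, Low)], [trA, trC, trD, trD, trF])"
proof -
  have "walk (Gt, High) w bs \<and> length w \<le> Suc (Suc (Suc (Suc (Suc (0)))))"
    using assms by simp
  then show ?thesis
    using assms(3-) by (simp only: walk_bounded) (elim disjE exE conjE; simp)
qed


section \<open>The three classes\<close>

text \<open>Here \<open>trA\<close> has a value at most \<open>a\<close> and \<open>trD\<close> one
  at least \<open>a\<close>, so \<open>(Lt, High)\<close> and \<open>(Lt, Mid)\<close> are empty.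
  The cases locate the minimum relative to the values of \<open>trE\<close> and \<open>trG\<close>,
  which decides where the word is cut off.\<close>

lemma system_path_Class_I:
  assumes le: "b \<le> c + T"
  shows "\<exists>p. (\<forall>p'. system_path n l p' \<longleftrightarrow> p' = p) \<and> p \<in> cut_off n l ` class_paths Class_I \<and>
    snd p \<noteq> [] \<and> hd (snd p) \<in> {trB, trBE}"
proof -
  note bounds = le lengths min_bounds
  consider (Mid) "c \<le> m" | (Low) "m < c" "b + c - a - T \<le> m" | (End) "m < b + c - a - T"
    by linarith
  then show ?thesis
  proof cases
    case Mid
    let ?p = "([(Gt, High), (Gt, Mid)], [trB])"
    have "run n l ?p"
      by (rule runI) (use Mid bounds in \<open>auto simp: block_lengths_iff le_Suc_eq\<close>)
    moreover have "(bs, w) = ?p" if "run n l (bs, w)" "length w \<le> length (snd ?p)" for bs w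
    proof -
      have last: "bs ! length w = (Gt, Mid)"
        by (rule run_last[OF that(1), of a "(Gt, Mid)"])
          (use Mid bounds in \<open>auto simp: block_lengths_iff\<close>)
      have walk: "walk (Gt, High) w bs"
        using that(1) by (simp add: run_iff)
      show ?thesis
        by (rule walk_to_Gt_Mid[OF walk _ last]) (use that(2) in simp)
    qed
    ultimately have "system_path n l p' \<longleftrightarrow> p' = ?p" for p'
      by (rule system_path_eqI)
    moreover have "?p \<in> cut_off n l ` class_paths Class_I"
      using Mid bounds by (auto simp: cut_off_def)
    ultimately show ?thesis by (intro exI[of _ ?p]) (simp del: class_paths.simps)
  next
    case Low
    \<comment> \<open>For \<open>a = c\<close> the middle zone is empty. Crossing it by
      \<open>trB\<close> and \<open>trE\<close> would also be a run, but a longer one than the run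
      with \<open>trBE\<close>.\<close>
    let ?p = "if a = c then ([(Gt, High), (Gt, Low)], [trBE])
      else ([(Gt, High), (Gt, Mid), (Gt, Low)], [trB, trE])"
    have "run n l ?p"
    proof (cases "a = c")
      case True
      show ?thesis
        unfolding if_P[OF True]
        by (rule runI) (use True Low bounds in \<open>auto simp: block_lengths_iff le_Suc_eq\<close>)
    next
      case False
      show ?thesis
        unfolding if_not_P[OF False]
        by (rule runI) (use False Low bounds in \<open>auto simp: block_lengths_iff le_Suc_eq less_Suc_eq\<close>)
    qed
    moreover have "(bs, w) = ?p" if "run n l (bs, w)" "length w \<le> length (snd ?p)" for bs w
    proof -
      have last: "bs ! length w = (Gt, Low)"
        by (rule run_last[OF that(1), of c "(Gt, Low)"])
          (use Low bounds in \<open>auto simp: block_lengths_iff\<close>)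
      have walk: "walk (Gt, High) w bs"
        using that(1) by (simp add: run_iff)
      show ?thesis
        using walk_to_Gt_Low[OF walk _ last] that(2) lengths by (auto split: if_splits)
    qed
    ultimately have "system_path n l p' \<longleftrightarrow> p' = ?p" for p'
      by (rule system_path_eqI)
    moreover have "?p \<in> cut_off n l ` class_paths Class_I"
      using Low bounds by (auto simp: cut_off_def)
    ultimately show ?thesis by (intro exI[of _ ?p]) (simp del: class_paths.simps)
  next
    case End
    let ?p = "if a = c then ([(Gt, High), (Gt, Low), (Lt, Low)], [trBE, trG])
      else ([(Gt, High), (Gt, Mid), (Gt, Low), (Lt, Low)], [trB, trE, trG])"
    have "run n l ?p"
    proof (cases "a = c")
      case True
      show ?thesis
        unfolding if_P[OF True]
        by (rule runI) (use True End bounds in \<open>auto simp: block_lengths_iff le_Suc_eq less_Suc_eq\<close>)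
    next
      case False
      show ?thesis
        unfolding if_not_P[OF False]
        by (rule runI) (use False End bounds in \<open>auto simp: block_lengths_iff le_Suc_eq less_Suc_eq\<close>)
    qed
    moreover have "(bs, w) = ?p" if r: "run n l (bs, w)" and len: "length w \<le> length (snd ?p)" for bs w
    proof -
      have last: "bs ! length w = (Lt, Low)"
        by (rule run_last[OF r, of "b + c - a - T" "(Lt, Low)"])
          (use End bounds in \<open>auto simp: block_lengths_iff\<close>)
      have walk: "walk (Gt, High) w bs" using r by (simp add: run_iff)
      show ?thesis
      proof (cases "a = c")
        case True
        then show ?thesis
          using walk_to_Lt_Low[OF walk _ last] len lengths by auto
      next
        case False
        then have "{c<..<a} \<subseteq> block_lengths (Gt, Mid)"
          using End bounds by (auto simp: block_lengths_iff intro!: attainable_interval)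
        then obtain z where z: "c < z" "z < a" "bs ! length (takeWhile (\<lambda>t. z < tv t) w) = (Gt, Mid)"
          using run_visits[OF r, of c a "(Gt, Mid)"] False End bounds by auto
        \<comment> \<open>Between the values of \<open>trF\<close> and \<open>trD\<close>, the word
          \<open>trB\<close>, \<open>trD\<close>, \<open>trF\<close> has already left
          \<open>(Gt, Mid)\<close>; the word beginning with \<open>trA\<close> never enters that
          block.\<close>
        then have "z < a - b + c + T" using le by simp
        then show ?thesis
          using walk_to_Lt_Low[OF walk _ last] z len False lengths
          by (auto split: if_splits)
      qed
    qed
    ultimately have "system_path n l p' \<longleftrightarrow> p' = ?p" for p'
      by (rule system_path_eqI)
    moreover have "?p \<in> cut_off n l ` class_paths Class_I"
      using End bounds by (auto simp: cut_off_def)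
    ultimately show ?thesis by (intro exI[of _ ?p]) (simp del: class_paths.simps)
  qed
qed

text \<open>The lengths strictly between the values of \<open>trC\<close> and \<open>trA\<close>
  form a nonempty interval in this block. Hence no run can start with \<open>trB\<close> or
  \<open>trBE\<close>, after which the block is out of reach.\<close>

lemma visits_Lt_High:
  assumes "run n l (bs, w)" "c + T < b"
  shows "(Lt, High) \<in> set bs"
proof (rule run_visits_set[OF assms(1), of a "a + b - c - T"])
  show "{a<..<a + b - c - T} \<subseteq> block_lengths (Lt, High)"
    using assms lengths min_bounds by (auto simp: block_lengths_iff intro!: attainable_interval)
qed (use assms min_bounds in auto)

text \<open>The two assumptions put the value of \<open>trD\<close> strictly between
  \<open>c\<close> and \<open>a\<close>. The cases again locate the minimum relative to the values
  of \<open>trE\<close> and \<open>trG\<close>.\<close>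

lemma system_path_Class_II:
  assumes less: "c + T < b" and generic: "b < a + T"
  shows "\<exists>p. (\<forall>p'. system_path n l p' \<longleftrightarrow> p' = p) \<and> p \<in> cut_off n l ` class_paths Class_II \<and>
    take 3 (snd p) = [trA, trC, trD]"
proof -
  note bounds = less generic lengths min_bounds
  \<comment> \<open>The minimum is \<open>0\<close> or \<open>a - b - c - T\<close>, both below the
    value of \<open>trD\<close>, so \<open>trD\<close> is never cut off.\<close>
  have m_less: "m < a - b + c + T" using bounds by auto
  consider (Mid) "c \<le> m" | (Low) "m < c" "b + c - a - T \<le> m" | (End) "m < b + c - a - T"
    by linarith
  then show ?thesis
  proof cases
    case Mid
    let ?p = "([(Gt, High), (Lt, High), (Lt, Mid), (Gt, Mid)], [trA, trC, trD])"
    have "run n l ?p"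
      by (rule runI)
        (use Mid bounds m_less in \<open>auto simp: block_lengths_iff le_Suc_eq less_Suc_eq\<close>)
    moreover have "(bs, w) = ?p" if "run n l (bs, w)" "length w \<le> length (snd ?p)" for bs w
    proof -
      have last: "bs ! length w = (Gt, Mid)"
        by (rule run_last[OF that(1), of "a - b + c + T" "(Gt, Mid)"])
          (use Mid bounds m_less in \<open>auto simp: block_lengths_iff\<close>)
      have walk: "walk (Gt, High) w bs"
        using that(1) by (simp add: run_iff)
      show ?thesis
        by (rule walk_via_Lt_High_to_Gt_Mid[OF walk _ last visits_Lt_High[OF that(1) less]])
          (use that(2) in simp)
    qed
    ultimately have "system_path n l p' \<longleftrightarrow> p' = ?p" for p'
      by (rule system_path_eqI)
    moreover have "?p \<in> cut_off n l ` class_paths Class_II"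
      using Mid bounds m_less by (auto simp: cut_off_def)
    ultimately show ?thesis by (intro exI[of _ ?p]) (simp del: class_paths.simps)
  next
    case Low
    let ?p = "([(Gt, High), (Lt, High), (Lt, Mid), (Gt, Mid), (Gt, Low)], [trA, trC, trD, trE])"
    have "run n l ?p"
      by (rule runI)
        (use Low bounds m_less in \<open>auto simp: block_lengths_iff le_Suc_eq less_Suc_eq\<close>)
    moreover have "(bs, w) = ?p" if "run n l (bs, w)" "length w \<le> length (snd ?p)" for bs w
    proof -
      have last: "bs ! length w = (Gt, Low)"
        by (rule run_last[OF that(1), of c "(Gt, Low)"])
          (use Low bounds in \<open>auto simp: block_lengths_iff\<close>)
      have walk: "walk (Gt, High) w bs"
        using that(1) by (simp add: run_iff)
      show ?thesis
        by (rule walk_via_Lt_High_to_Gt_Low[OF walk _ last visits_Lt_High[OF that(1) less]])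
          (use that(2) in simp)
    qed
    ultimately have "system_path n l p' \<longleftrightarrow> p' = ?p" for p'
      by (rule system_path_eqI)
    moreover have "?p \<in> cut_off n l ` class_paths Class_II"
      using Low bounds m_less by (auto simp: cut_off_def)
    ultimately show ?thesis by (intro exI[of _ ?p]) (simp del: class_paths.simps)
  next
    case End
    let ?p = "([(Gt, High), (Lt, High), (Lt, Mid), (Gt, Mid), (Gt, Low), (Lt, Low)],
      [trA, trC, trD, trE, trG])"
    have "run n l ?p"
      by (rule runI)
        (use End bounds m_less in \<open>auto simp: block_lengths_iff le_Suc_eq less_Suc_eq\<close>)
    moreover have "(bs, w) = ?p" if r: "run n l (bs, w)" and len: "length w \<le> length (snd ?p)" for bs w
    proof -
      have last: "bs ! length w = (Lt, Low)"
        by (rule run_last[OF r, of "b + c - a - T" "(Lt, Low)"])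
          (use End bounds in \<open>auto simp: block_lengths_iff\<close>)
      have walk: "walk (Gt, High) w bs" using r by (simp add: run_iff)
      \<comment> \<open>At these lengths \<open>trA\<close>, \<open>trC\<close> and every
        \<open>trD\<close> have been made, but not \<open>trE\<close> or \<open>trF\<close>: the
        word without \<open>trD\<close> is in \<open>(Lt, Mid)\<close>, and the word with two of
        them has returned there.\<close>
      have "{c<..<a - b + c + T} \<subseteq> block_lengths (Gt, Mid)"
        using End bounds by (auto simp: block_lengths_iff intro!: attainable_interval)
      then obtain z where z: "c < z" "z < a - b + c + T"
        "bs ! length (takeWhile (\<lambda>t. z < tv t) w) = (Gt, Mid)"
        using run_visits[OF r, of c "a - b + c + T" "(Gt, Mid)"] End bounds by auto
      then have "z < a" "z < a + b - c - T" using bounds by auto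
      then show ?thesis
        using walk_via_Lt_High_to_Lt_Low[OF walk _ last visits_Lt_High[OF r less]] z len by auto
    qed
    ultimately have "system_path n l p' \<longleftrightarrow> p' = ?p" for p'
      by (rule system_path_eqI)
    moreover have "?p \<in> cut_off n l ` class_paths Class_II"
      using End bounds m_less by (auto simp: cut_off_def)
    ultimately show ?thesis by (intro exI[of _ ?p]) (simp del: class_paths.simps)
  qed
qed

text \<open>\<open>trD\<close>, \<open>trE\<close>, \<open>trF\<close> and \<open>trG\<close> all
  have the value \<open>c\<close>, so \<open>(Gt, Mid)\<close> and \<open>(Gt, Low)\<close> are
  empty. The class II word would be a run as well; minimality selects the shorter one. The minimum
  is \<open>0\<close>, and nothing is cut off.\<close>

lemma system_path_Class_III:
  assumes less: "c < b" and [simp]: "T = 0" "a = b"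
  shows "\<exists>p. (\<forall>p'. system_path n l p' \<longleftrightarrow> p' = p) \<and> p \<in> cut_off n l ` class_paths Class_III \<and>
    take 3 (snd p) = [trA, trC, trF]"
proof -
  note bounds = less lengths min_bounds
  have [simp]: "m = 0"
    using bounds by auto
  let ?p = "([(Gt, High), (Lt, High), (Lt, Mid), (Lt, Low)], [trA, trC, trF])"
  have "run n l ?p"
    by (rule runI) (use bounds in \<open>auto simp: block_lengths_iff le_Suc_eq less_Suc_eq\<close>)
  moreover have "(bs, w) = ?p" if "run n l (bs, w)" "length w \<le> length (snd ?p)" for bs w
  proof -
    have last: "bs ! length w = (Lt, Low)"
      by (rule run_last[OF that(1), of c "(Lt, Low)"])
        (use bounds in \<open>auto simp: block_lengths_iff\<close>)
    have walk: "walk (Gt, High) w bs"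
      using that(1) by (simp add: run_iff)
    have "(Lt, High) \<in> set bs"
      using visits_Lt_High[OF that(1)] less by simp
    then show ?thesis
      using walk_via_Lt_High_to_Lt_Low[OF walk _ last] that(2) by auto
  qed
  ultimately have "system_path n l p' \<longleftrightarrow> p' = ?p" for p'
    by (rule system_path_eqI)
  moreover have "?p \<in> cut_off n l ` class_paths Class_III"
    using bounds by (auto simp: cut_off_def)
  ultimately show ?thesis by (intro exI[of _ ?p]) (simp del: class_paths.simps)
qed

text \<open>Truncated paths of different classes may coincide, since \<open>trA\<close>,
  \<open>trC\<close> begins the words of both II and III. The first transition recognises class I,
  and a third one tells II from III.\<close>

lemma cut_off_Class_hd:
  assumes "p \<in> cut_off n l ` class_paths k" "snd p \<noteq> []"
  shows "hd (snd p) \<in> {trB, trBE} \<longleftrightarrow> k = Class_I"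
  using assms by (cases k) (auto simp: cut_off_def split: if_splits)

lemma cut_off_Class_third:
  assumes "p \<in> cut_off n l ` class_paths k" "take 3 (snd p) = [trA, trC, t]"
  shows "t = trD \<longleftrightarrow> k = Class_II" "t = trF \<longleftrightarrow> k = Class_III"
  using assms by (cases k; auto simp: cut_off_def split: if_splits)+

lemma class_of_arm:
  defines "k \<equiv> if b \<le> c + T then Class_I else if n \<noteq> 3 \<or> a \<noteq> b then Class_II else Class_III"
  shows "\<exists>!p. system_path n l p" "takes_class n l k' \<longleftrightarrow> k' = k"
proof -
  \<comment> \<open>As the path is unique, \<open>takes_class\<close> reduces to membership of this
    one path in a truncated class.\<close>
  have "\<exists>p. (\<forall>p'. system_path n l p' \<longleftrightarrow> p' = p) \<and>
      (\<forall>k'. p \<in> cut_off n l ` class_paths k' \<longleftrightarrow> k' = k)"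
  proof -
    consider "b \<le> c + T" "k = Class_I" | "c + T < b" "b < a + T" "k = Class_II"
      | "c < b" "T = 0" "a = b" "k = Class_III"
    proof (cases "b \<le> c + T"; cases "n \<noteq> 3 \<or> a \<noteq> b")
      assume "\<not> b \<le> c + T" "n \<noteq> 3 \<or> a \<noteq> b"
      \<comment> \<open>For \<open>n \<noteq> 3\<close> the sum \<open>T\<close> is positive;
        otherwise \<open>b < a\<close>.\<close>
      moreover from this have "b < a + T"
        using lengths rest_eq_0_iff by linarith
      ultimately show thesis
        using that(2) by (simp add: k_def)
    next
      assume "\<not> b \<le> c + T" "\<not> (n \<noteq> 3 \<or> a \<noteq> b)"
      then show thesis
        using that(3) rest_eq_0_iff by (simp add: k_def)
    qed (use that(1) in \<open>simp_all add: k_def\<close>)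
    then show ?thesis
    proof cases
      case 1
      with system_path_Class_I show ?thesis using cut_off_Class_hd by metis
    next
      case 2
      with system_path_Class_II show ?thesis using cut_off_Class_third(1) by metis
    next
      case 3
      with system_path_Class_III show ?thesis using cut_off_Class_third(2) by metis
    qed
  qed
  then obtain p where p: "\<And>p'. system_path n l p' \<longleftrightarrow> p' = p"
    "\<And>k'. p \<in> cut_off n l ` class_paths k' \<longleftrightarrow> k' = k"
    by blast
  show "\<exists>!p. system_path n l p"
    using p(1) by simp
  show "takes_class n l k' \<longleftrightarrow> k' = k"
    using p(2)[of k'] by (auto simp: takes_class_def p(1))
qed

end


section \<open>Arbitrary arms, a truncated path and the null set of class III\<close>

lemma takes_class_iff:
  assumes "planar_arm n l"
  shows "\<exists>!p. system_path n l p"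
    and "takes_class n l k \<longleftrightarrow> k = (if l (n - 2) \<le> (\<Sum>i<n - 2. l i) then Class_I
           else if n \<noteq> 3 \<or> l (n - 1) \<noteq> l (n - 2) then Class_II else Class_III)"
proof -
  interpret arm n l "l (n - 1)" "l (n - 2)" "l (n - 3)" "\<Sum>j<n - 3. l j"
    using assms by unfold_locales auto
  show "\<exists>!p. system_path n l p" by (rule class_of_arm)
  show "takes_class n l k \<longleftrightarrow> k = (if l (n - 2) \<le> (\<Sum>i<n - 2. l i) then Class_I
      else if n \<noteq> 3 \<or> l (n - 1) \<noteq> l (n - 2) then Class_II else Class_III)"
    unfolding class_of_arm(2) sum_short ..
qed

text \<open>A base segment so long that the base-length never drops below \<open>l (n - 3)\<close> cuts the path off
  after its first transition.\<close>

lemma truncated_path_exists: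
  assumes "3 \<le> n"
  shows "\<exists>l p. planar_arm n l \<and> system_path n l p \<and> (\<forall>k. p \<notin> class_paths k)"
proof -
  \<comment> \<open>The other \<open>n - 1\<close> segments have length \<open>1\<close>, so the
    minimum is \<open>(n + 1) - (n - 1) = 2\<close>, above the value \<open>1\<close> of
    \<open>trE\<close>.\<close>
  define l :: "nat \<Rightarrow> real" where "l i = (if i = n - 1 then real n + 1 else 1)" for i
  have planar: "planar_arm n l"
    using assms by (auto simp: planar_arm_def l_def)
  have "(\<Sum>j<n - 3. l j) = (\<Sum>j<n - 3. 1)"
    by (intro sum.cong) (auto simp: l_def)
  then have sum: "(\<Sum>j<n - 3. l j) = real n - 3"
    using assms by (simp add: of_nat_diff)
  interpret arm n l "real n + 1" 1 1 "real n - 3"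
    using planar sum assms by unfold_locales (auto simp: l_def)
  have m: "m = 2"
    using assms by (simp add: min_base_length_eq)
  obtain p where p: "system_path n l p" "p \<in> cut_off n l ` class_paths Class_I"
    using system_path_Class_I assms by auto
  have "length (snd p) \<le> 1"
    using p(2) by (auto simp: cut_off_def m)
  then have "p \<notin> class_paths k" for k
    by (cases k) auto
  then show ?thesis using planar p(1) by blast
qed

text \<open>Fubini: once all coordinates except \<open>i\<close> are fixed, the section of the
  hyperplane is the single point \<open>x j\<close>, which has measure zero.\<close>

lemma null_sets_coordinates_eq:
  assumes "finite I" "i \<in> I" "j \<in> I" "i \<noteq> j"
  shows "{x \<in> space (\<Pi>\<^sub>M k\<in>I. lborel). x i = x j} \<in> null_sets (\<Pi>\<^sub>M k\<in>I. (lborel :: real measure))"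
    (is "?H \<in> _")
proof -
  interpret product_sigma_finite "\<lambda>_. lborel :: real measure" ..
  define J where "J = I - {i}"
  have J: "I = insert i J" "i \<notin> J" "finite J" "j \<in> J"
    using assms by (auto simp: J_def)
  have meas: "?H \<in> sets (\<Pi>\<^sub>M k\<in>I. lborel)"
    using assms by measurable
  have "emeasure (\<Pi>\<^sub>M k\<in>I. lborel) ?H = (\<integral>\<^sup>+ x. indicator ?H x \<partial>(\<Pi>\<^sub>M k\<in>insert i J. lborel))"
    using meas J(1) by simp
  also have "\<dots> = (\<integral>\<^sup>+ x. (\<integral>\<^sup>+ y. indicator ?H (x(i := y)) \<partial>lborel) \<partial>(\<Pi>\<^sub>M k\<in>J. lborel))"
    using meas J by (intro product_nn_integral_insert) auto
  also have "\<dots> = (\<integral>\<^sup>+ x. 0 \<partial>(\<Pi>\<^sub>M k\<in>J. (lborel :: real measure)))"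
  proof (rule nn_integral_cong)
    show "(\<integral>\<^sup>+ y. indicator ?H (x(i := y)) \<partial>lborel) = 0" for x
    proof -
      have "(\<integral>\<^sup>+ y. indicator ?H (x(i := y)) \<partial>lborel) \<le> (\<integral>\<^sup>+ y. indicator {x j} y \<partial>(lborel :: real measure))"
        using assms(4) by (intro nn_integral_mono) (auto simp: indicator_def)
      then show ?thesis by simp
    qed
  qed
  finally show ?thesis
    using meas by (simp add: null_sets_def)
qed

text \<open>For \<open>n = 3\<close> the set lies in the hyperplane \<open>l 1 = l 2\<close>; for
  other \<open>n\<close> it is empty. Membership in \<open>null_sets\<close> includes measurability,
  so the set is written explicitly as the hyperplane cut by a measurable set.\<close>

lemma null_sets_Class_III:
  "{l \<in> space (\<Pi>\<^sub>M j\<in>{..<n}. lborel). planar_arm n l \<and> takes_class n l Class_III}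
     \<in> null_sets (\<Pi>\<^sub>M j\<in>{..<n}. lborel)"
proof (cases "n = 3")
  case True
  let ?M = "\<Pi>\<^sub>M j\<in>{..<3::nat}. (lborel :: real measure)"
  have "{l \<in> space ?M. planar_arm 3 l \<and> takes_class 3 l Class_III} =
      {l \<in> space ?M. 0 < l 0 \<and> l 0 < l 1 \<and> l 1 = l 2}"
  proof -
    have planar: "planar_arm 3 l \<longleftrightarrow> 0 < l 0 \<and> l 0 \<le> l 1 \<and> l 1 \<le> l 2" for l
    proof
      assume *: "0 < l 0 \<and> l 0 \<le> l 1 \<and> l 1 \<le> l 2"
      have "0 < l i" if "i < 3" for i
      proof -
        have "i = 0 \<or> i = 1 \<or> i = 2" using that by linarith
        then show ?thesis using * by (elim disjE) simp_all
      qed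
      moreover have "l i \<le> l j" if "i \<le> j" "j < 3" for i j
      proof -
        have "i = j \<or> i = 0 \<and> j = 1 \<or> i = 0 \<and> j = 2 \<or> i = 1 \<and> j = 2"
          using that by linarith
        then show ?thesis using * by (elim disjE) simp_all
      qed
      ultimately show "planar_arm 3 l"
        by (simp add: planar_arm_def)
    qed (auto simp: planar_arm_def)
    have "planar_arm 3 l \<and> takes_class 3 l Class_III \<longleftrightarrow> 0 < l 0 \<and> l 0 < l 1 \<and> l 1 = l 2" for l
    proof (cases "planar_arm 3 l")
      case True
      then have "takes_class 3 l Class_III \<longleftrightarrow> \<not> l 1 \<le> l 0 \<and> l 2 = l 1"
        by (simp add: takes_class_iff)
      then show ?thesis using planar[of l] True by linarith
    next
      case False
      then show ?thesis using planar[of l] by linarith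
    qed
    then show ?thesis by simp
  qed
  also have "\<dots> = {l \<in> space ?M. l 1 = l 2} \<inter> {l \<in> space ?M. 0 < l 0 \<and> l 0 < l 1}"
    by auto
  also have "\<dots> \<in> null_sets ?M"
  proof (rule null_set_Int2)
    show "{l \<in> space ?M. l 1 = l 2} \<in> null_sets ?M"
      by (rule null_sets_coordinates_eq) auto
    show "{l \<in> space ?M. 0 < l 0 \<and> l 0 < l 1} \<in> sets ?M"
      by measurable
  qed
  finally show ?thesis using True by simp
next
  case False
  then have "{l \<in> space (\<Pi>\<^sub>M j\<in>{..<n}. lborel). planar_arm n l \<and> takes_class n l Class_III} = {}"
    by (auto simp: takes_class_iff)
  then show ?thesis by (metis null_sets.empty_sets)
qed


theorem proposition4:
  fixes n :: nat
  assumes "n \<ge> 3"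
  shows
    "(\<forall>l. planar_arm n l \<longrightarrow>
        (\<exists>!p. system_path n l p) \<and>
        (\<exists>!c. takes_class n l c) \<and>
        (takes_class n l Class_I \<longleftrightarrow> l (n - 2) \<le> (\<Sum>i<n - 2. l i)) \<and>
        (takes_class n l Class_II \<longleftrightarrow>
           l (n - 2) > (\<Sum>i<n - 2. l i) \<and> (n \<noteq> 3 \<or> l (n - 1) \<noteq> l (n - 2))) \<and>
        (takes_class n l Class_III \<longleftrightarrow>
           l (n - 2) > (\<Sum>i<n - 2. l i) \<and> n = 3 \<and> l (n - 1) = l (n - 2))) \<and>
     (\<exists>l p. planar_arm n l \<and> system_path n l p \<and> (\<forall>c. p \<notin> class_paths c)) \<and>
     {l \<in> space (\<Pi>\<^sub>M j\<in>{..<n}. lborel). planar_arm n l \<and> takes_class n l Class_III}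
       \<in> null_sets (\<Pi>\<^sub>M j\<in>{..<n}. lborel)"
proof (intro conjI allI impI)
  fix l
  assume "planar_arm n l"
  note arm = takes_class_iff[OF this]
  show "\<exists>!p. system_path n l p" by (rule arm(1))
  show "\<exists>!c. takes_class n l c" by (simp add: arm(2))
  show "takes_class n l Class_I \<longleftrightarrow> l (n - 2) \<le> (\<Sum>i<n - 2. l i)"
    by (simp add: arm(2))
  show "takes_class n l Class_II \<longleftrightarrow>
      l (n - 2) > (\<Sum>i<n - 2. l i) \<and> (n \<noteq> 3 \<or> l (n - 1) \<noteq> l (n - 2))"
    by (auto simp: arm(2))
  show "takes_class n l Class_III \<longleftrightarrow>
      l (n - 2) > (\<Sum>i<n - 2. l i) \<and> n = 3 \<and> l (n - 1) = l (n - 2)"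
    by (auto simp: arm(2))
next
  show "\<exists>l p. planar_arm n l \<and> system_path n l p \<and> (\<forall>c. p \<notin> class_paths c)"
    using assms by (rule truncated_path_exists)
next
  show "{l \<in> space (\<Pi>\<^sub>M j\<in>{..<n}. lborel). planar_arm n l \<and> takes_class n l Class_III}
      \<in> null_sets (\<Pi>\<^sub>M j\<in>{..<n}. lborel)"
    by (rule null_sets_Class_III)
qed

end
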